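(* Let $g\in\mathbb{R}^n\setminus\{0\}$, let $H$ be a real symmetric $n\times n$ matrix, and let $\rho:\mathbb{R}\to[0,\infty]$ be a proper closed convex function with $\rho(0)=0$. Suppose that: (1) $\rho$ is nondecreasing, $\rho(t)=0$ for all $t\le 0$, and there exists $t_0>0$ with $\rho(t_0)<\infty$; (2) $\lim_{t\to\infty}\rho(t)/t=\infty$; (3) the monotone conjugate $\rho^+$ is differentiable at every $t>0$. For $t\in\mathbb{R}$ let $$\lambda(t):=\lambda_{\min}\left(\begin{bmatrix}t&g^T\\ g&H\end{bmatrix}\right),\qquad \widehat k(t):=\inf_{\gamma\ge 0}\{\rho(\gamma-1)+\gamma\lambda(t)\},$$ and let $\bar t:=\lim_{\lambda\uparrow\lambda_{\min}(H)}[\lambda+g^T(H-\lambda I)^{-1}g]\in(-\infty,\infty]$. Then the following hold. (i) For each $t\in\mathbb{R}$, the infimum defining $\widehat k(t)$ is attained, and the set of minimizers $\gamma$ is $$\begin{cases}\{0\}&\text{if }\lambda(t)>0,\\ (\operatorname{arg\,min}\rho+1)\cap\mathbb{R}_+&\text{if }\lambda(t)=0,\\ \{(\rho^+)'(-\lambda(t))+1\}&\text{otherwise.}\end{cases}$$ (ii) $\widehat k$ is a continuous concave function. (iii) The superdifferential of $\widehat k$ at any $t\in\mathbb{R}$ is the convex hull of the set of all numbers of the form $\gamma v_0^2$, where $\gamma$ attains the infimum defining $\widehat k(t)$ and $\begin{bmatrix}v_0&\bar v^T\end{bmatrix}^T\in\mathbb{R}^{n+1}$ (with $v_0\in\mathbb{R}$)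 is a unit eigenvector of $\begin{bmatrix}t&g^T\\ g&H\end{bmatrix}$ corresponding to $\lambda(t)$. (iv) $\widehat k$ is differentiable except possibly at the two points: $\bar t$; and also $g^TH^{-1}g$ if $\lim_{t\uparrow\bar t}\lambda(t)>0$.
   Context: $\lambda_{\min}(A)$ is the smallest eigenvalue of a real symmetric matrix $A$, $I$ the identity matrix, $\mathbb{R}_+=[0,\infty)$. The monotone conjugate of $\rho$ is $\rho^+(u):=\sup_{t\ge 0}\{ut-\rho(t)\}$. The superdifferential of a concave function $f$ at $t$ is $-\partial(-f)(t)$, where $\partial$ is the convex subdifferential. $\operatorname{arg\,min}\rho+1$ is the set $\operatorname{arg\,min}\rho$ translated by $1$. If $\bar t=\infty$ it does not count as an exceptional point in (iv). *)

theory Defs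
  imports "HOL-Analysis.Analysis"
begin

section \<open>Smallest eigenvalue and the bordered matrix\<close>

definition eigenvector :: "real^'m^'m \<Rightarrow> real^'m \<Rightarrow> real \<Rightarrow> bool" where
  "eigenvector A v \<mu> \<longleftrightarrow> v \<noteq> 0 \<and> A *v v = \<mu> *\<^sub>R v"

text \<open>Only meaningful if a smallest real eigenvalue exists, as it does for symmetric matrices.\<close>
definition lambda_min :: "real^'m^'m \<Rightarrow> real" where
  "lambda_min A = (LEAST \<mu>. \<exists>v. eigenvector A v \<mu>)"

text \<open>
  The index type \<open>'n option\<close> has one more element than \<open>'n\<close>: \<open>None\<close> is the leading
  coordinate (so \<open>v $ None\<close> is the scalar \<open>v\<^sub>0\<close>), and \<open>Some i\<close> are the remaining ones.
\<close>
definition bordered :: "real^'n \<Rightarrow> real^'n^'n \<Rightarrow> real \<Rightarrow> real^('n option)^('n option)" where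
  "bordered g H t = (\<chi> i j.
     case i of
       None \<Rightarrow> (case j of None \<Rightarrow> t | Some b \<Rightarrow> g $ b)
     | Some a \<Rightarrow> (case j of None \<Rightarrow> g $ a | Some b \<Rightarrow> H $ a $ b))"

definition lam :: "real^'n \<Rightarrow> real^'n^'n \<Rightarrow> real \<Rightarrow> real" where
  "lam g H t = lambda_min (bordered g H t)"

text \<open>The limit is taken in the extended reals; its value may be \<open>\<infinity>\<close>.\<close>
definition tbar :: "real^'n \<Rightarrow> real^'n^'n \<Rightarrow> ereal" where
  "tbar g H = Lim (at_left (lambda_min H))
     (\<lambda>l. ereal (l + g \<bullet> (matrix_inv (H - l *\<^sub>R mat 1) *v g)))"


section \<open>Extended-real-valued convex functions\<close>

definition epigraph_ereal :: "(real \<Rightarrow> ereal) \<Rightarrow> (real \<times> real) set" where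
  "epigraph_ereal f = {(x, r). f x \<le> ereal r}"

text \<open>``Closed'' is lower semicontinuity, i.e. closedness of the epigraph.\<close>
definition proper_closed_convex :: "(real \<Rightarrow> ereal) \<Rightarrow> bool" where
  "proper_closed_convex f \<longleftrightarrow>
     (\<forall>x. f x \<noteq> -\<infinity>) \<and> (\<exists>x. f x \<noteq> \<infinity>) \<and>
     closed (epigraph_ereal f) \<and> convex (epigraph_ereal f)"

definition monotone_conjugate :: "(real \<Rightarrow> ereal) \<Rightarrow> real \<Rightarrow> ereal" where
  "monotone_conjugate \<rho> u = (SUP t\<in>{0..}. ereal (u * t) - \<rho> t)"

text \<open>
  Differentiability of an extended-real-valued function at a point requires it to be finite
  near that point; \<open>real_of_ereal\<close> on its own would silently replace infinite values by \<open>0\<close>.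
\<close>
definition ereal_differentiable_at :: "(real \<Rightarrow> ereal) \<Rightarrow> real \<Rightarrow> bool" where
  "ereal_differentiable_at f x \<longleftrightarrow>
     (\<forall>\<^sub>F y in nhds x. \<bar>f y\<bar> \<noteq> \<infinity>) \<and> (\<lambda>y. real_of_ereal (f y)) differentiable (at x)"

definition ereal_deriv :: "(real \<Rightarrow> ereal) \<Rightarrow> real \<Rightarrow> real" where
  "ereal_deriv f x = deriv (\<lambda>y. real_of_ereal (f y)) x"

definition subdifferential :: "(real \<Rightarrow> ereal) \<Rightarrow> real \<Rightarrow> real set" where
  "subdifferential f t = {d. \<forall>s. f t + ereal (d * (s - t)) \<le> f s}"

definition superdifferential :: "(real \<Rightarrow> ereal) \<Rightarrow> real \<Rightarrow> real set" where
  "superdifferential f t = uminus ` subdifferential (\<lambda>s. - f s) t"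

definition argmin_set :: "(real \<Rightarrow> ereal) \<Rightarrow> real set" where
  "argmin_set f = {x. is_arg_min f (\<lambda>_. True) x}"


section \<open>The dual objective\<close>

definition khat_obj ::
    "(real \<Rightarrow> ereal) \<Rightarrow> real^'n \<Rightarrow> real^'n^'n \<Rightarrow> real \<Rightarrow> real \<Rightarrow> ereal" where
  "khat_obj \<rho> g H t \<gamma> = \<rho> (\<gamma> - 1) + ereal (\<gamma> * lam g H t)"

definition khat :: "(real \<Rightarrow> ereal) \<Rightarrow> real^'n \<Rightarrow> real^'n^'n \<Rightarrow> real \<Rightarrow> ereal" where
  "khat \<rho> g H t = (INF \<gamma>\<in>{0..}. khat_obj \<rho> g H t \<gamma>)"

definition khat_minimizers ::
    "(real \<Rightarrow> ereal) \<Rightarrow> real^'n \<Rightarrow> real^'n^'n \<Rightarrow> real \<Rightarrow> real set" where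
  "khat_minimizers \<rho> g H t = {\<gamma>\<in>{0..}. khat_obj \<rho> g H t \<gamma> = khat \<rho> g H t}"

text \<open>
  The points at which \<open>khat\<close> may fail to be differentiable.  An infinite \<open>tbar\<close> contributes no
  point.  Composing with \<open>real_of_ereal\<close> makes the limit along \<open>at_left (tbar g H)\<close> the usual
  left limit when \<open>tbar\<close> is finite and the limit along \<open>at_top\<close> when it is \<open>\<infinity>\<close>
  (cf. \<open>ereal_tendsto_simps1\<close>).
\<close>
definition exceptional_points :: "real^'n \<Rightarrow> real^'n^'n \<Rightarrow> real set" where
  "exceptional_points g H =
     {t. ereal t = tbar g H} \<union>
     (if Lim (at_left (tbar g H)) (lam g H \<circ> real_of_ereal) > 0
      then {g \<bullet> (matrix_inv H *v g)} else {})"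

end

(*
  The smallest eigenvalue is the minimum of the Rayleigh quotient, and the quadratic form of the
  bordered matrix is affine in t.  Hence khat(t) is the minimum over multipliers gamma >= 0 and
  unit vectors v of rho(gamma - 1) + gamma * v^T A(t) v, a family of affine functions of t with
  slopes gamma * v0^2.  This gives a supergradient at every t, hence concavity.  Superlinearity
  of rho makes the minimizers bounded, so the set of optimal slopes has a closed graph in t
  (Danskin); as supergradients are monotone, limits of optimal slopes from the right and from the
  left bracket any supergradient, which yields (iii), and khat is differentiable wherever the
  optimal slope is unique.

  For (iv) put phi(l) = l + g^T (H - l I)^{-1} g.  By a Schur complement, lambda(phi(l)) = l for
  l < lambda_min(H), and tbar is the supremum of phi there.  For t > tbar, lambda is locally
  constant.  For t < tbar, lambda(t) < lambda_min(H), so eigenvectors for lambda(t) are determined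
  by their leading entry and the slope is unique unless lambda(t) = 0, that is t = phi(0).
*)
theory Submission imports Defs
begin

section \<open>Smallest eigenvalues\<close>

lemma symmetric_inner_matrix:
  fixes A :: "real^'m^'m"
  assumes "transpose A = A"
  shows "(A *v x) \<bullet> y = x \<bullet> (A *v y)"
  by (metis assms dot_lmul_matrix transpose_matrix_vector)

lemma matrix_inv_mult:
  fixes A :: "real^'m^'m"
  assumes "invertible A"
  shows "A ** matrix_inv A = mat 1" "matrix_inv A ** A = mat 1"
  using someI_ex[OF assms[unfolded invertible_def]] by (simp_all add: matrix_inv_def)

text \<open>A zero of a nonnegative form is a minimum, so the gradient \<open>2 * B v\<close> must
  vanish there; the proof tests the form along the direction \<open>w = B v\<close>.\<close>

lemma psd_form_zero_imp_kernel:
  fixes B :: "real^'m^'m"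
  assumes sym: "transpose B = B" and psd: "\<And>x. 0 \<le> x \<bullet> (B *v x)" and zero: "v \<bullet> (B *v v) = 0"
  shows "B *v v = 0"
proof -
  define w where "w = B *v v"
  define c where "c = w \<bullet> (B *v w)"
  \<comment> \<open>Along \<open>v + e w\<close> the form is \<open>2 e |w|^2 + e^2 c\<close>,
    minimal at \<open>-|w|^2 / c\<close>. The denominator \<open>c + 1\<close> avoids division by
    zero when \<open>c = 0\<close> and still makes the value negative unless
    \<open>w = 0\<close>.\<close>
  define e where "e = - (w \<bullet> w) / (c + 1)"
  have c: "c \<ge> 0" using psd by (simp add: c_def)
  have "(v + e *\<^sub>R w) \<bullet> (B *v (v + e *\<^sub>R w)) = 2 * e * (w \<bullet> w) + e\<^sup>2 * c"
    using symmetric_inner_matrix[OF sym, of v w] zero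
    by (simp add: matrix_vector_right_distrib matrix_vector_mult_scaleR inner_simps c_def
        flip: w_def) (simp add: inner_commute algebra_simps power2_eq_square w_def)
  then have "0 \<le> 2 * e * (w \<bullet> w) + e\<^sup>2 * c" using psd by metis
  also have "\<dots> = - (w \<bullet> w)\<^sup>2 * (c + 2) / (c + 1)\<^sup>2"
    using c unfolding e_def by (simp add: divide_simps) (simp add: algebra_simps power2_eq_square)
  finally have "(w \<bullet> w)\<^sup>2 * (c + 2) \<le> 0"
    using c by (simp add: divide_simps)
  then have "(w \<bullet> w)\<^sup>2 \<le> 0"
    using c mult_pos_pos[of "(w \<bullet> w)\<^sup>2" "c + 2"] by linarith
  then show ?thesis by (simp add: w_def)
qed

text \<open>By compactness the Rayleigh quotient attains its minimum \<mu> at some unit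
  \<open>v\<close>. Then \<open>A - \<mu> I\<close> is positive semidefinite with form zero at
  \<open>v\<close>, so \<open>v\<close> is in its kernel. Eigenvalues are Rayleigh values, so \<mu>
  is the one picked by \<open>LEAST\<close>.\<close>

lemma lambda_min_symmetric:
  fixes A :: "real^'m^'m"
  assumes sym: "transpose A = A"
  shows lambda_min_le_rayleigh: "lambda_min A * (x \<bullet> x) \<le> x \<bullet> (A *v x)"
    and ex_unit_eigenvector_lambda_min: "\<exists>v. norm v = 1 \<and> eigenvector A v (lambda_min A)"
    and lambda_min_le_eigenvalue: "eigenvector A u \<nu> \<Longrightarrow> lambda_min A \<le> \<nu>"
proof -
  have cont: "continuous_on (sphere 0 1) (\<lambda>x. x \<bullet> (A *v x))"
    by (intro continuous_intros)
  obtain v where v: "norm v = 1"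
    and vmin: "\<And>y. norm y = 1 \<Longrightarrow> v \<bullet> (A *v v) \<le> y \<bullet> (A *v y)"
    using continuous_attains_inf[OF compact_sphere _ cont] by fastforce
  define \<mu> where "\<mu> = v \<bullet> (A *v v)"
  have ray: "\<mu> * (x \<bullet> x) \<le> x \<bullet> (A *v x)" for x
  proof (cases "x = 0")
    case False
    have "\<mu> \<le> (x /\<^sub>R norm x) \<bullet> (A *v (x /\<^sub>R norm x))"
      unfolding \<mu>_def using False by (intro vmin) simp
    also have "\<dots> = (x \<bullet> (A *v x)) / (norm x)\<^sup>2"
      by (simp add: matrix_vector_mult_scaleR power2_eq_square divide_inverse)
    finally show ?thesis
      using False by (simp add: pos_le_divide_eq power2_norm_eq_inner)
  qed auto
  define B where "B = A - \<mu> *\<^sub>R mat 1"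
  have Bv: "B *v x = A *v x - \<mu> *\<^sub>R x" for x
    by (simp add: B_def matrix_vector_mult_diff_rdistrib flip: scaleR_matrix_vector_assoc)
  have "transpose B = B"
    using sym by (auto simp: B_def transpose_def vec_eq_iff mat_def)
  then have "B *v v = 0"
    using ray v
    by (intro psd_form_zero_imp_kernel)
       (auto simp: Bv inner_diff_right \<mu>_def norm_eq_1)
  then have ev: "eigenvector A v \<mu>"
    using v by (auto simp: eigenvector_def Bv)
  have le: "\<mu> \<le> \<nu>" if "eigenvector A u \<nu>" for u \<nu>
    using ray[of u] that by (auto simp: eigenvector_def)
  have "lambda_min A = \<mu>"
    unfolding lambda_min_def using ev le by (intro Least_equality) auto
  then show "lambda_min A * (x \<bullet> x) \<le> x \<bullet> (A *v x)"
    "\<exists>v. norm v = 1 \<and> eigenvector A v (lambda_min A)"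
    "eigenvector A u \<nu> \<Longrightarrow> lambda_min A \<le> \<nu>"
    using ray ev v le by auto
qed

section \<open>Bordered matrices\<close>

definition vcons :: "real \<Rightarrow> real^'n \<Rightarrow> real^('n option)" where
  "vcons a y = (\<chi> i. case i of None \<Rightarrow> a | Some j \<Rightarrow> y $ j)"

definition vtail :: "real^('n option) \<Rightarrow> real^'n" where
  "vtail x = (\<chi> i. x $ Some i)"

lemma vcons_simps [simp]: "vcons a y $ None = a" "vtail (vcons a y) = y"
  by (simp_all add: vcons_def vtail_def vec_eq_iff)

lemma vec_option_eq_iff: "x = y \<longleftrightarrow> x $ None = y $ None \<and> vtail x = vtail y"
  by (auto simp: vtail_def vec_eq_iff split_option_all)

lemma sum_UNIV_option: "(\<Sum>i\<in>(UNIV::'n::finite option set). f i) = f None + (\<Sum>i\<in>UNIV. f (Some i))"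
  by (simp add: UNIV_option_conv sum.reindex)

lemma inner_option: "x \<bullet> y = x $ None * y $ None + vtail x \<bullet> vtail y"
  for x y :: "real^('n::finite option)"
  by (simp add: inner_vec_def sum_UNIV_option vtail_def)

lemma vtail_linear [simp]:
  "vtail (x + y) = vtail x + vtail y" "vtail (x - y) = vtail x - vtail y" "vtail (c *\<^sub>R x) = c *\<^sub>R vtail x" "vtail 0 = 0"
  by (simp_all add: vtail_def vec_eq_iff)

lemma bordered_mult:
  "(bordered g H t *v x) $ None = t * x $ None + g \<bullet> vtail x"
  "vtail (bordered g H t *v x) = x $ None *\<^sub>R g + H *v vtail x"
  by (simp_all add: bordered_def matrix_vector_mult_def sum_UNIV_option inner_vec_def vtail_def
      vec_eq_iff mult.commute)

lemma bordered_form: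
  "x \<bullet> (bordered g H t *v x)
     = t * (x $ None)\<^sup>2 + 2 * x $ None * (g \<bullet> vtail x) + vtail x \<bullet> (H *v vtail x)"
  by (simp add: inner_option bordered_mult inner_add_right inner_commute power2_eq_square
      algebra_simps)

lemma bordered_symmetric: "transpose H = H \<Longrightarrow> transpose (bordered g H t) = bordered g H t"
  by (auto simp: transpose_def bordered_def vec_eq_iff split: option.split)

lemma eigenvector_bordered_iff:
  "eigenvector (bordered g H t) v \<mu> \<longleftrightarrow> v \<noteq> 0 \<and> t * v $ None + g \<bullet> vtail v = \<mu> * v $ None
     \<and> v $ None *\<^sub>R g + H *v vtail v = \<mu> *\<^sub>R vtail v"
  by (subst eigenvector_def, subst vec_option_eq_iff[of "bordered g H t *v v"]) (simp add: bordered_mult)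

section \<open>The smallest eigenvalue of the bordered matrix as a function of t\<close>

locale bordered_matrix =
  fixes g :: "real^'n" and H :: "real^'n^'n"
  assumes sym: "transpose H = H"
begin

abbreviation lH where "lH \<equiv> lambda_min H"

definition min_eigenvectors :: "real \<Rightarrow> (real^('n option)) set" where
  "min_eigenvectors t = {v. norm v = 1 \<and> eigenvector (bordered g H t) v (lam g H t)}"

lemma lam_le: "lam g H t * (x \<bullet> x) \<le> x \<bullet> (bordered g H t *v x)"
  unfolding lam_def by (rule lambda_min_le_rayleigh[OF bordered_symmetric[OF sym]])

lemma min_eigenvectors_nonempty: "min_eigenvectors t \<noteq> {}"
  using ex_unit_eigenvector_lambda_min[OF bordered_symmetric[OF sym], of g t]
  by (auto simp: lam_def min_eigenvectors_def)

text \<open>A minimizing vector at t is a test vector at s, and its form is affine in the corner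
  entry with slope \<open>v0^2\<close>.\<close>

lemma lam_supergradient:
  assumes "v \<in> min_eigenvectors t"
  shows "lam g H s \<le> lam g H t + (v $ None)\<^sup>2 * (s - t)"
proof -
  have v: "v \<bullet> v = 1" "bordered g H t *v v = lam g H t *\<^sub>R v"
    using assms by (auto simp: min_eigenvectors_def eigenvector_def norm_eq_1)
  have "lam g H s \<le> v \<bullet> (bordered g H s *v v)"
    using lam_le[of s v] v by simp
  also have "\<dots> = v \<bullet> (bordered g H t *v v) + (v $ None)\<^sup>2 * (s - t)"
    by (simp add: bordered_form algebra_simps)
  finally show ?thesis using v by simp
qed

lemma lam_mono: "s \<le> t \<Longrightarrow> lam g H s \<le> lam g H t"
proof -
  assume "s \<le> t"
  obtain v where "v \<in> min_eigenvectors t" using min_eigenvectors_nonempty by auto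
  from lam_supergradient[OF this, of s] show ?thesis
    using mult_nonneg_nonpos[of "(v $ None)\<^sup>2" "s - t"] \<open>s \<le> t\<close> by simp
qed

text \<open>The test vector is \<open>(0, y)\<close> with \<open>y\<close> a minimizing eigenvector
  of \<open>H\<close>; its form does not depend on t.\<close>

lemma lam_le_lambda_min: "lam g H t \<le> lH"
proof -
  obtain y where y: "norm y = 1" "eigenvector H y lH"
    using ex_unit_eigenvector_lambda_min[OF sym] by auto
  have "vcons 0 y \<bullet> vcons 0 y = 1"
    using y by (simp add: inner_option norm_eq_1)
  then show ?thesis
    using lam_le[of t "vcons 0 y"] y by (simp add: bordered_form eigenvector_def norm_eq_1)
qed

section \<open>The resolvent of \<open>H\<close> below \<open>lH\<close> and the threshold
  \<open>tbar\<close>\<close>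

lemma shift_mult: "(H - l *\<^sub>R mat 1) *v x = H *v x - l *\<^sub>R x"
  by (simp add: matrix_vector_mult_diff_rdistrib flip: scaleR_matrix_vector_assoc)

lemma shift_kernel: "l < lH \<Longrightarrow> H *v y = l *\<^sub>R y \<Longrightarrow> y = 0"
  using lambda_min_le_eigenvalue[OF sym, of y l] by (auto simp: eigenvector_def)

lemma shift_invertible: "l < lH \<Longrightarrow> invertible (H - l *\<^sub>R mat 1)"
  using shift_kernel by (auto simp: invertible_left_inverse matrix_left_invertible_ker shift_mult)

lemma shift_inverse:
  assumes "l < lH"
  shows "H *v (matrix_inv (H - l *\<^sub>R mat 1) *v y) = y + l *\<^sub>R (matrix_inv (H - l *\<^sub>R mat 1) *v y)"
    and "matrix_inv (H - l *\<^sub>R mat 1) *v (H *v y - l *\<^sub>R y) = y"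
proof -
  let ?B = "H - l *\<^sub>R mat 1"
  have "?B ** matrix_inv ?B = mat 1" "matrix_inv ?B ** ?B = mat 1"
    using shift_invertible[OF assms] by (simp_all add: matrix_inv_mult)
  then have "?B *v (matrix_inv ?B *v y) = y" "matrix_inv ?B *v (?B *v y) = y"
    by (simp_all add: matrix_vector_mul_assoc)
  then show "H *v (matrix_inv ?B *v y) = y + l *\<^sub>R (matrix_inv ?B *v y)"
    "matrix_inv ?B *v (H *v y - l *\<^sub>R y) = y"
    unfolding shift_mult by (auto simp: algebra_simps)
qed

text \<open>The corner entry t at which the Schur complement
  \<open>t - l - g^T (H - l I)^{-1} g\<close> of \<open>H - l I\<close> in the shifted bordered
  matrix vanishes. Its left limit at \<open>lH\<close> is \<open>tbar\<close>.\<close>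

definition phi :: "real \<Rightarrow> real" where
  "phi l = l + g \<bullet> (matrix_inv (H - l *\<^sub>R mat 1) *v g)"

text \<open>The bound from above comes from the eigenvector \<open>(1, -p)\<close>, where
  \<open>-p\<close> solves the tail equations for leading entry 1. For the bound from below, the
  shifted bordered form at \<open>(a, y)\<close> is the form of \<open>H - l I\<close> at
  \<open>y + a p\<close>, nonnegative since \<open>l < lH\<close>.\<close>

lemma lam_phi:
  assumes "l < lH"
  shows "lam g H (phi l) = l"
proof (rule antisym)
  define p where "p = matrix_inv (H - l *\<^sub>R mat 1) *v g"
  have Hp: "H *v p = g + l *\<^sub>R p" using shift_inverse(1)[OF assms] by (simp add: p_def)
  have phi: "phi l = l + g \<bullet> p" by (simp add: phi_def p_def)
  have "vcons 1 (- p) \<noteq> 0" by (auto simp: vec_option_eq_iff)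
  moreover have "H *v (- p) = - (H *v p)"
    by (simp add: vec_eq_iff matrix_vector_mult_def sum_negf)
  ultimately have "eigenvector (bordered g H (phi l)) (vcons 1 (- p)) l"
    by (simp add: eigenvector_bordered_iff phi Hp)
  then show "lam g H (phi l) \<le> l"
    unfolding lam_def by (rule lambda_min_le_eigenvalue[OF bordered_symmetric[OF sym]])
  obtain v where v: "v \<in> min_eigenvectors (phi l)" using min_eigenvectors_nonempty by auto
  then have v1: "v \<bullet> v = 1" "bordered g H (phi l) *v v = lam g H (phi l) *\<^sub>R v"
    by (auto simp: min_eigenvectors_def eigenvector_def norm_eq_1)
  define a y where "a = v $ None" and "y = vtail v"
  have "lH * ((y + a *\<^sub>R p) \<bullet> (y + a *\<^sub>R p)) \<le> (y + a *\<^sub>R p) \<bullet> (H *v (y + a *\<^sub>R p))"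
    by (rule lambda_min_le_rayleigh[OF sym])
  moreover have "l * ((y + a *\<^sub>R p) \<bullet> (y + a *\<^sub>R p)) \<le> lH * ((y + a *\<^sub>R p) \<bullet> (y + a *\<^sub>R p))"
    using assms by (intro mult_right_mono) auto
  ultimately have "0 \<le> (y + a *\<^sub>R p) \<bullet> (H *v (y + a *\<^sub>R p)) - l * ((y + a *\<^sub>R p) \<bullet> (y + a *\<^sub>R p))"
    by linarith
  \<comment> \<open>Schur complement: completing the square in the bordered form\<close>
  also have "\<dots> = v \<bullet> (bordered g H (phi l) *v v) - l * (v \<bullet> v)"
  proof -
    have "p \<bullet> (H *v y) = g \<bullet> y + l * (p \<bullet> y)"
      by (metis Hp symmetric_inner_matrix[OF sym] inner_add_left inner_scaleR_left)
    moreover have "H *v (y + a *\<^sub>R p) = H *v y + a *\<^sub>R g + (a * l) *\<^sub>R p"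
      by (simp add: matrix_vector_right_distrib matrix_vector_mult_scaleR Hp scaleR_add_right)
    ultimately show ?thesis
      unfolding bordered_form phi a_def[symmetric] y_def[symmetric]
        inner_option[of v v] inner_add_left inner_add_right
      by (simp add: inner_simps inner_commute algebra_simps power2_eq_square)
  qed
  finally show "l \<le> lam g H (phi l)" using v1 by simp
qed

text \<open>No derivative of the resolvent is taken: \<open>lam\<close> is monotone and a left
  inverse of \<open>phi\<close>.\<close>

lemma phi_strict_mono:
  assumes "l < l'" "l' < lH"
  shows "phi l < phi l'"
proof (rule ccontr)
  assume "\<not> phi l < phi l'"
  then have "lam g H (phi l') \<le> lam g H (phi l)" by (intro lam_mono) simp
  then show False using lam_phi[of l] lam_phi[of l'] assms by simp
qed

text \<open>A monotone function converges from the left to its supremum, in the extended reals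
  without a case split on finiteness.\<close>

lemma tbar_eq: "tbar g H = (SUP l\<in>{..<lH}. ereal (phi l))"
  unfolding tbar_def
proof (rule tendsto_Lim)
  show "((\<lambda>l. ereal (l + g \<bullet> (matrix_inv (H - l *\<^sub>R mat 1) *v g)))
      \<longlongrightarrow> (SUP l\<in>{..<lH}. ereal (phi l))) (at_left lH)"
    unfolding phi_def[symmetric]
  proof (rule order_tendstoI)
    fix a assume "a < (SUP l\<in>{..<lH}. ereal (phi l))"
    then obtain l where l: "l < lH" "a < ereal (phi l)" by (auto simp: less_SUP_iff)
    have "a < ereal (phi l')" if "l < l'" "l' < lH" for l'
      using l phi_strict_mono[OF that] by (meson ereal_less_eq(3) less_imp_le less_le_trans)
    then show "\<forall>\<^sub>F l in at_left lH. a < ereal (phi l)"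
      using l by (auto simp: eventually_at_left)
  next
    fix a assume "(SUP l\<in>{..<lH}. ereal (phi l)) < a"
    then have "ereal (phi l) < a" if "l < lH" for l
      using that by (meson SUP_upper lessThan_iff le_less_trans)
    then show "\<forall>\<^sub>F l in at_left lH. ereal (phi l) < a"
      by (auto simp: eventually_at_filter)
  qed
qed simp

lemma phi_less_tbar: "l < lH \<Longrightarrow> ereal (phi l) < tbar g H"
proof -
  assume "l < lH"
  then obtain l' where "l < l'" "l' < lH" using dense by blast
  then show ?thesis
    using phi_strict_mono[of l l'] unfolding tbar_eq
    by (metis SUP_upper ereal_less(2) less_ereal.simps(1) less_le_trans lessThan_iff)
qed

lemma lam_less_lambda_min:
  assumes "ereal t < tbar g H"
  shows "lam g H t < lH"
proof -
  obtain l where "l < lH" "t < phi l"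
    using assms by (auto simp: tbar_eq less_SUP_iff)
  then show ?thesis using lam_mono[of t "phi l"] lam_phi[of l] by simp
qed

text \<open>Such a t lies above every \<open>phi l\<close>, so monotonicity gives
  \<open>lam g H t \<ge> l\<close> for each \<open>l < lH\<close>.\<close>

lemma lam_eq_lambda_min:
  assumes "tbar g H \<le> ereal t"
  shows "lam g H t = lH"
proof (rule antisym[OF lam_le_lambda_min], rule dense_le)
  fix l assume "l < lH"
  then have "phi l \<le> t"
    using phi_less_tbar[of l] assms
    by (metis ereal_less_eq(3) less_imp_le order.trans)
  then show "l \<le> lam g H t"
    using lam_mono[of "phi l" t] lam_phi[OF \<open>l < lH\<close>] by simp
qed

text \<open>Turns the condition in \<open>exceptional_points\<close> into \<open>lH > 0\<close>. To
  the right of \<open>phi l\<close>, \<open>lam\<close> is squeezed between \<open>l\<close> and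
  \<open>lH\<close>.\<close>

lemma Lim_lam_tbar: "Lim (at_left (tbar g H)) (lam g H \<circ> real_of_ereal) = lH"
proof (rule tendsto_Lim)
  \<comment> \<open>At \<open>-\<infinity>\<close> the left filter would be trivial and
    \<open>Lim\<close> would not be determined.\<close>
  have "tbar g H \<noteq> -\<infinity>" using phi_less_tbar[of "lH - 1"] by auto
  then show "at_left (tbar g H) \<noteq> bot"
    by (cases "tbar g H") (auto simp: at_left_ereal at_left_PInf filtermap_bot_iff)
  show "((lam g H \<circ> real_of_ereal) \<longlongrightarrow> lH) (at_left (tbar g H))"
  proof (rule order_tendstoI)
    fix a assume "a < lH"
    then obtain l where l: "a < l" "l < lH" using dense by blast
    have "a < lam g H (real_of_ereal x)" if x: "ereal (phi l) < x" "x < tbar g H" for x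
    proof -
      obtain r where "x = ereal r" using x by (cases x) auto
      then show ?thesis
        using x lam_mono[of "phi l" r] lam_phi[OF l(2)] l by simp
    qed
    then show "\<forall>\<^sub>F x in at_left (tbar g H). a < (lam g H \<circ> real_of_ereal) x"
      using phi_less_tbar[OF l(2)] unfolding o_def
      by (subst eventually_at_left) auto
  next
    fix a assume "lH < a"
    then show "\<forall>\<^sub>F x in at_left (tbar g H). (lam g H \<circ> real_of_ereal) x < a"
      using lam_le_lambda_min le_less_trans by (intro always_eventually) fastforce
  qed
qed

text \<open>The combination \<open>x\<close> of \<open>v\<close> and \<open>w\<close> cancels the
  leading entry, so its tail would be an eigenvector of \<open>H\<close> below \<open>lH\<close> and
  must vanish. The vectors are then proportional, and both have norm 1.\<close>

lemma min_eigenvector_lead_unique: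
  assumes "lam g H t < lH" "v \<in> min_eigenvectors t" "w \<in> min_eigenvectors t"
  shows "(v $ None)\<^sup>2 = (w $ None)\<^sup>2"
proof -
  define x where "x = w $ None *\<^sub>R v - v $ None *\<^sub>R w"
  have "bordered g H t *v x = lam g H t *\<^sub>R x"
    using assms unfolding x_def min_eigenvectors_def eigenvector_def
    by (simp add: matrix_vector_mult_diff_distrib matrix_vector_mult_scaleR algebra_simps)
  moreover have "x $ None = 0" by (simp add: x_def)
  ultimately have "H *v vtail x = lam g H t *\<^sub>R vtail x"
    using bordered_mult(2)[of g H t x] by simp
  then have "vtail x = 0" using shift_kernel assms by blast
  then have "x = 0" using \<open>x $ None = 0\<close> by (auto simp: vec_option_eq_iff)
  then have "norm (w $ None *\<^sub>R v) = norm (v $ None *\<^sub>R w)" by (simp add: x_def)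
  then have "\<bar>v $ None\<bar> = \<bar>w $ None\<bar>"
    using assms by (simp add: min_eigenvectors_def)
  then show ?thesis by (metis power2_abs)
qed

text \<open>The tail equations give \<open>vtail v = - v0 H^{-1} g\<close>, so
  \<open>v0 \<noteq> 0\<close>, and dividing the first row by \<open>v0\<close> determines
  t.\<close>

lemma lam_zero_imp:
  assumes "lam g H t = 0" "0 < lH"
  shows "t = g \<bullet> (matrix_inv H *v g)"
proof -
  obtain v where v: "v \<in> min_eigenvectors t" using min_eigenvectors_nonempty by auto
  then have ev: "v \<noteq> 0" "t * v $ None + g \<bullet> vtail v = 0"
    "v $ None *\<^sub>R g + H *v vtail v = 0"
    using assms by (auto simp: min_eigenvectors_def eigenvector_bordered_iff)
  have inv: "matrix_inv H *v (H *v y) = y" for y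
    using shift_inverse(2)[OF assms(2), of y] by simp
  have "matrix_inv H *v (v $ None *\<^sub>R g + H *v vtail v) = 0" using ev by simp
  then have tail: "vtail v = - (v $ None *\<^sub>R (matrix_inv H *v g))"
    unfolding matrix_vector_right_distrib matrix_vector_mult_scaleR inv
    by (metis eq_neg_iff_add_eq_0 add.commute)
  have "v $ None \<noteq> 0"
    using tail ev(1) by (auto simp: vec_option_eq_iff)
  moreover have "v $ None * (t - g \<bullet> (matrix_inv H *v g)) = 0"
    using ev(2) tail by (simp add: algebra_simps)
  ultimately show ?thesis by simp
qed

end

section \<open>Scalar dual problem\<close>

lemma ereal_add_le_iff: "a + ereal x \<le> ereal y \<longleftrightarrow> a \<le> ereal (y - x)"
  by (cases a) auto

locale penalty =
  fixes \<rho> :: "real \<Rightarrow> ereal"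
  assumes nonneg: "0 \<le> \<rho> t"
    and closed_epigraph: "closed (epigraph_ereal \<rho>)"
    and nonpos: "t \<le> 0 \<Longrightarrow> \<rho> t = 0"
    and superlinear: "((\<lambda>t. \<rho> t / ereal t) \<longlongrightarrow> \<infinity>) at_top"
    and conjugate_differentiable: "u > 0 \<Longrightarrow> ereal_differentiable_at (monotone_conjugate \<rho>) u"
begin

text \<open>The eigenvalue is replaced by a free real \<open>l\<close>, which separates the scalar
  problem from the matrix.\<close>

definition obj :: "real \<Rightarrow> real \<Rightarrow> ereal" where
  "obj l \<gamma> = \<rho> (\<gamma> - 1) + ereal (\<gamma> * l)"

definition val :: "real \<Rightarrow> ereal" where
  "val l = (INF \<gamma>\<in>{0..}. obj l \<gamma>)"

definition minimizers :: "real \<Rightarrow> real set" where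
  "minimizers l = {\<gamma>\<in>{0..}. obj l \<gamma> = val l}"

text \<open>Superlinear growth of \<rho> beats any linear bound; this coercivity is the source of
  all compactness in \<gamma>.\<close>

lemma sublevel_bounded: "\<exists>R. \<forall>\<gamma>\<ge>0. \<rho> (\<gamma> - 1) \<le> ereal (1 + \<gamma> * M) \<longrightarrow> \<gamma> \<le> R"
proof -
  \<comment> \<open>With \<open>s = \<gamma> - 1 > 1\<close> one has
    \<open>\<gamma> \<le> 2 s\<close>, hence the factor \<open>2 * \<bar>M\<bar>\<close>; the extra
    1 absorbs the constant 1 of the sublevel.\<close>
  obtain N where N: "\<And>s. s \<ge> N \<Longrightarrow> ereal (2 * \<bar>M\<bar> + 1) < \<rho> s / ereal s"
    using superlinear unfolding tendsto_PInfty eventually_at_top_linorder by blast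
  have "\<gamma> \<le> max N 1 + 1" if le: "\<rho> (\<gamma> - 1) \<le> ereal (1 + \<gamma> * M)" for \<gamma>
  proof (rule ccontr)
    assume "\<not> ?thesis"
    then have s: "\<gamma> - 1 \<ge> N" "\<gamma> - 1 > 1" by auto
    obtain r where r: "\<rho> (\<gamma> - 1) = ereal r"
      using le nonneg[of "\<gamma> - 1"] by (cases "\<rho> (\<gamma> - 1)") auto
    have "2 * \<bar>M\<bar> + 1 < r / (\<gamma> - 1)" using N[OF s(1)] r s by simp
    then have "(2 * \<bar>M\<bar> + 1) * (\<gamma> - 1) < r" using s by (simp add: pos_less_divide_eq)
    moreover have "\<gamma> * M \<le> (2 * (\<gamma> - 1)) * \<bar>M\<bar>"
    proof -
      have "\<gamma> * M \<le> \<gamma> * \<bar>M\<bar>" using s by (intro mult_left_mono) auto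
      also have "\<dots> \<le> (2 * (\<gamma> - 1)) * \<bar>M\<bar>" using s by (intro mult_right_mono) auto
      finally show ?thesis .
    qed
    moreover have "r \<le> 1 + \<gamma> * M" using le r by simp
    ultimately show False using s by (simp add: algebra_simps)
  qed
  then show ?thesis by blast
qed

lemma obj_zero: "obj l 0 = 0"
  by (simp add: obj_def nonpos)

lemma obj_ge: "ereal (\<gamma> * l) \<le> obj l \<gamma>"
  using nonneg[of "\<gamma> - 1"] by (cases "\<rho> (\<gamma> - 1)") (auto simp: obj_def)

text \<open>Constant \<open>l\<close> gives attainment; varying \<open>l\<close> gives the closed graph of the optimal slopes.\<close>
lemma obj_sublevel_compact:
  assumes \<gamma>: "\<And>n. 0 \<le> \<gamma> n" and le: "\<And>n. obj (l n) (\<gamma> n) \<le> ereal (m n)"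
    and l: "l \<longlonglongrightarrow> l0" and m: "m \<longlonglongrightarrow> m0" and m1: "\<And>n. m n \<le> 1"
  obtains r \<gamma>0 where "strict_mono r" "(\<gamma> \<circ> r) \<longlonglongrightarrow> \<gamma>0" "0 \<le> \<gamma>0" "obj l0 \<gamma>0 \<le> ereal m0"
proof -
  obtain M where M: "\<And>n. norm (l n) \<le> M"
    using convergent_imp_Bseq[OF convergentI[OF l]] BseqE by blast
  obtain R where R: "\<And>\<gamma>. 0 \<le> \<gamma> \<Longrightarrow> \<rho> (\<gamma> - 1) \<le> ereal (1 + \<gamma> * M) \<Longrightarrow> \<gamma> \<le> R"
    using sublevel_bounded by blast
  have epi: "\<rho> (\<gamma> n - 1) \<le> ereal (m n - \<gamma> n * l n)" for n
    using le[of n] by (simp add: obj_def ereal_add_le_iff)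
  have "\<gamma> n \<in> {0..R}" for n
  proof -
    have "\<gamma> n * - l n \<le> \<gamma> n * M"
      using \<gamma>[of n] M[of n] by (intro mult_left_mono) auto
    then have "m n - \<gamma> n * l n \<le> 1 + \<gamma> n * M" using m1[of n] by simp
    then have "\<rho> (\<gamma> n - 1) \<le> ereal (1 + \<gamma> n * M)" using epi[of n] by (meson ereal_less_eq(3) order.trans)
    then show ?thesis using R[OF \<gamma>] \<gamma> by simp
  qed
  then obtain \<gamma>0 r where r: "\<gamma>0 \<in> {0..R}" "strict_mono r" "(\<gamma> \<circ> r) \<longlonglongrightarrow> \<gamma>0"
    using compact_Icc[of 0 R] unfolding compact_def by metis
  \<comment> \<open>These points lie in the closed epigraph, so lower semicontinuity is used with
    real sequences only.\<close>
  have "(\<lambda>n. (\<gamma> (r n) - 1, m (r n) - \<gamma> (r n) * l (r n))) \<longlonglongrightarrow> (\<gamma>0 - 1, m0 - \<gamma>0 * l0)"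
    using r(3) LIMSEQ_subseq_LIMSEQ[OF l r(2)] LIMSEQ_subseq_LIMSEQ[OF m r(2)]
    unfolding o_def by (intro tendsto_intros)
  then have "(\<gamma>0 - 1, m0 - \<gamma>0 * l0) \<in> epigraph_ereal \<rho>"
    by (rule closed_sequentially[OF closed_epigraph, rotated]) (simp add: epigraph_ereal_def epi)
  then have "obj l0 \<gamma>0 \<le> ereal m0"
    by (simp add: epigraph_ereal_def obj_def ereal_add_le_iff)
  with r that show ?thesis by auto
qed

lemma val_le: "0 \<le> \<gamma> \<Longrightarrow> val l \<le> obj l \<gamma>"
  unfolding val_def by (rule INF_lower) simp

text \<open>Where the objective is at most 1, \<gamma> is bounded by \<open>R\<close> and the linear
  term is bounded below; elsewhere the objective exceeds 1. The choice \<open>\<gamma> = 0\<close>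
  gives the upper bound.\<close>

lemma val_finite: "\<bar>val l\<bar> \<noteq> \<infinity>"
proof -
  obtain R where R: "\<And>\<gamma>. 0 \<le> \<gamma> \<Longrightarrow> \<rho> (\<gamma> - 1) \<le> ereal (1 + \<gamma> * - l) \<Longrightarrow> \<gamma> \<le> R"
    using sublevel_bounded by blast
  have "ereal (- (\<bar>R\<bar> * \<bar>l\<bar>)) \<le> obj l \<gamma>" if "0 \<le> \<gamma>" for \<gamma>
  proof (cases "obj l \<gamma> \<le> ereal 1")
    case True
    then have "\<gamma> \<le> R" using that by (intro R) (simp_all add: obj_def ereal_add_le_iff)
    then have "\<bar>\<gamma> * l\<bar> \<le> \<bar>R\<bar> * \<bar>l\<bar>"
      using that unfolding abs_mult by (intro mult_right_mono) auto
    then have "ereal (- (\<bar>R\<bar> * \<bar>l\<bar>)) \<le> ereal (\<gamma> * l)" by simp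
    then show ?thesis using obj_ge order.trans by blast
  next
    case False
    have "ereal (- (\<bar>R\<bar> * \<bar>l\<bar>)) \<le> ereal 1"
      using mult_nonneg_nonneg[of "\<bar>R\<bar>" "\<bar>l\<bar>"] by (simp del: mult_nonneg_nonneg)
    then show ?thesis using False by (meson linear order.trans)
  qed
  then have "ereal (- (\<bar>R\<bar> * \<bar>l\<bar>)) \<le> val l" unfolding val_def by (intro INF_greatest) simp
  moreover have "val l \<le> 0" using val_le[of 0 l] obj_zero by simp
  ultimately show ?thesis by (cases "val l") auto
qed

text \<open>Direct method: \<open>obj_sublevel_compact\<close> is applied to a minimizing sequence
  with errors \<open>1 / (n + 1)\<close>.\<close>

lemma minimizers_nonempty: "minimizers l \<noteq> {}"
proof -
  obtain m where m: "val l = ereal m" using val_finite[of l] by (cases "val l") auto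
  have m0: "m \<le> 0" using val_le[of 0 l] obj_zero m by simp
  have "\<exists>\<gamma>\<ge>0. obj l \<gamma> \<le> ereal (m + inverse (Suc n))" for n
  proof -
    have "val l < ereal (m + inverse (Suc n))" by (simp add: m)
    then show ?thesis unfolding val_def INF_less_iff by (auto intro: less_imp_le)
  qed
  then obtain \<gamma> where \<gamma>: "\<And>n. 0 \<le> \<gamma> n" "\<And>n. obj l (\<gamma> n) \<le> ereal (m + inverse (Suc n))"
    by metis
  have "(\<lambda>n. m + inverse (Suc n)) \<longlonglongrightarrow> m"
    using tendsto_add[OF tendsto_const LIMSEQ_inverse_real_of_nat] by simp
  moreover have "m + inverse (Suc n) \<le> 1" for n
  proof -
    have "inverse (real (Suc n)) \<le> 1" by (simp add: inverse_le_1_iff)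
    then show ?thesis using m0 by linarith
  qed
  ultimately obtain \<gamma>0 where "0 \<le> \<gamma>0" "obj l \<gamma>0 \<le> ereal m"
    by (rule obj_sublevel_compact[OF \<gamma> tendsto_const])
  then show ?thesis using val_le[of \<gamma>0 l] m by (auto simp: minimizers_def)
qed

section \<open>The minimizers for positive, zero and negative \<open>l\<close>\<close>

lemma minimizers_pos:
  assumes "l > 0"
  shows "minimizers l = {0}"
proof -
  have "\<gamma> = 0" if "\<gamma> \<in> minimizers l" for \<gamma>
  proof -
    have "ereal (\<gamma> * l) \<le> obj l \<gamma>" by (rule obj_ge)
    also have "\<dots> = val l" using that by (simp add: minimizers_def)
    also have "\<dots> \<le> 0" using val_le[of 0 l] obj_zero by simp
    finally have "\<gamma> * l \<le> 0" by simp
    then show ?thesis using assms that by (simp add: minimizers_def mult_le_0_iff)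
  qed
  then show ?thesis using minimizers_nonempty by blast
qed

lemma minimizers_zero: "minimizers 0 = ((\<lambda>x. x + 1) ` argmin_set \<rho>) \<inter> {0..}"
proof -
  have "val 0 = 0"
    unfolding val_def by (rule antisym; intro INF_lower2[of 0] INF_greatest)
      (auto simp: obj_def nonpos nonneg zero_ereal_def[symmetric])
  moreover have "argmin_set \<rho> = {x. \<rho> x = 0}"
    using nonneg nonpos[of 0] unfolding argmin_set_def is_arg_min_def
    by (auto simp: not_less intro: antisym) (metis nonneg antisym order.refl)
  moreover have "(\<gamma> \<in> (\<lambda>x. x + 1) ` {x. \<rho> x = 0}) = (\<rho> (\<gamma> - 1) = 0)" for \<gamma>
    by (auto intro!: image_eqI[of _ _ "\<gamma> - 1"])
  ultimately show ?thesis
    unfolding minimizers_def by (auto simp: obj_def zero_ereal_def[symmetric])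
qed

text \<open>With \<open>s = \<gamma> - 1\<close> the problem is to maximize
  \<open>(- l) s - \<rho> s\<close>. Optimality makes the affine function
  \<open>y (\<gamma> - 1) - r\<close> a minorant of the conjugate that touches it at
  \<open>- l\<close>, so its slope is the derivative there.\<close>

lemma minimizer_neg:
  assumes "l < 0" and min: "\<gamma> \<in> minimizers l"
  shows "\<gamma> = ereal_deriv (monotone_conjugate \<rho>) (- l) + 1"
proof -
  let ?u = "- l" and ?c = "monotone_conjugate \<rho>"
  define R where "R y = real_of_ereal (?c y)" for y
  have \<gamma>: "0 \<le> \<gamma>" and opt: "\<And>s. 0 \<le> s \<Longrightarrow> obj l \<gamma> \<le> obj l s"
    using min val_le by (auto simp: minimizers_def)
  have opt1: "obj l \<gamma> \<le> ereal l" using opt[of 1] by (simp add: obj_def nonpos)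
  then obtain r where r: "\<rho> (\<gamma> - 1) = ereal r"
    using nonneg[of "\<gamma> - 1"] by (cases "\<rho> (\<gamma> - 1)") (auto simp: obj_def)
  \<comment> \<open>The conjugate only ranges over nonnegative arguments, so
    \<open>\<gamma> - 1\<close> must be one of them. Below 1 the objective is at least
    \<open>\<gamma> l > l\<close>, its value at 1.\<close>
  have "1 \<le> \<gamma>"
  proof (rule ccontr)
    assume "\<not> 1 \<le> \<gamma>"
    moreover have "\<gamma> * l \<le> 1 * l" using obj_ge[of \<gamma> l] opt1 order.trans by fastforce
    ultimately show False using assms by (simp add: mult_le_cancel_right)
  qed
  have ge: "ereal (y * (\<gamma> - 1) - r) \<le> ?c y" for y
    unfolding monotone_conjugate_def using \<open>1 \<le> \<gamma>\<close> r by (intro SUP_upper2[of "\<gamma> - 1"]) auto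
  have "?c ?u \<le> ereal (?u * (\<gamma> - 1) - r)"
    unfolding monotone_conjugate_def
  proof (intro SUP_least)
    fix s :: real assume "s \<in> {0..}"
    then have "obj l \<gamma> \<le> obj l (s + 1)" by (intro opt) simp
    then show "ereal (?u * s) - \<rho> s \<le> ereal (?u * (\<gamma> - 1) - r)"
      using r by (cases "\<rho> s") (auto simp: obj_def algebra_simps)
  qed
  then have eq: "R ?u = ?u * (\<gamma> - 1) - r"
    using ge[of ?u] unfolding R_def by (metis antisym real_of_ereal.simps(1))
  have diff: "ereal_differentiable_at ?c ?u" using conjugate_differentiable assms by simp
  \<comment> \<open>\<open>R\<close> is faithful only where the conjugate is finite, which
    differentiability supplies near \<open>?u\<close>.\<close>
  have "\<forall>\<^sub>F y in nhds ?u. y * (\<gamma> - 1) - r \<le> R y"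
    using diff[unfolded ereal_differentiable_at_def, THEN conjunct1]
  proof eventually_elim
    case (elim y)
    then show ?case using ge[of y] by (cases "?c y") (auto simp: R_def)
  qed
  then obtain d where d: "0 < d" "\<And>y. \<bar>y - ?u\<bar> < d \<Longrightarrow> y * (\<gamma> - 1) - r \<le> R y"
    unfolding eventually_nhds_metric dist_real_def by blast
  have "R differentiable at ?u"
    using diff unfolding ereal_differentiable_at_def R_def by simp
  then have "(R has_real_derivative deriv R ?u) (at ?u)"
    using DERIV_deriv_iff_real_differentiable by blast
  then have "((\<lambda>y. R y - (y * (\<gamma> - 1) - r)) has_real_derivative deriv R ?u - (\<gamma> - 1)) (at ?u)"
    by (auto intro!: derivative_eq_intros)
  then have "deriv R ?u - (\<gamma> - 1) = 0"
    using d eq by (intro DERIV_local_min[of _ _ ?u d]) (auto simp: abs_minus_commute)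
  then show ?thesis
    unfolding ereal_deriv_def R_def by simp
qed

lemma minimizers_eq:
  "minimizers l = (if l > 0 then {0}
     else if l = 0 then ((\<lambda>x. x + 1) ` argmin_set \<rho>) \<inter> {0..}
     else {ereal_deriv (monotone_conjugate \<rho>) (- l) + 1})"
proof -
  have "minimizers l = {ereal_deriv (monotone_conjugate \<rho>) (- l) + 1}" if "l < 0"
    using minimizer_neg[OF that] minimizers_nonempty[of l] by blast
  then show ?thesis using minimizers_pos minimizers_zero by auto
qed

end

section \<open>Supergradients of the dual objective\<close>

text \<open>Take the supergradient at the convex combination itself; the linear terms then cancel in
  the average.\<close>

lemma concave_on_real_supergradient:
  fixes f :: "real \<Rightarrow> real"
  assumes "\<And>t. \<exists>d. \<forall>s. f s \<le> f t + d * (s - t)"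
  shows "concave_on UNIV f"
  unfolding concave_on_iff
proof (intro conjI ballI allI impI)
  fix x y u v :: real
  assume uv: "0 \<le> u" "0 \<le> v" "u + v = 1"
  define t where "t = u *\<^sub>R x + v *\<^sub>R y"
  obtain d where d: "\<And>s. f s \<le> f t + d * (s - t)" using assms by blast
  have "u * f x + v * f y \<le> u * (f t + d * (x - t)) + v * (f t + d * (y - t))"
    using d uv by (intro add_mono mult_left_mono)
  also have "\<dots> = (u + v) * f t + d * (u * x + v * y - (u + v) * t)"
    by (simp add: algebra_simps)
  finally show "u * f x + v * f y \<le> f (u *\<^sub>R x + v *\<^sub>R y)"
    using uv by (simp add: t_def)
qed auto

lemma concave_on_real_continuous:
  fixes f :: "real \<Rightarrow> real"
  assumes "concave_on UNIV f"
  shows "continuous_on UNIV f"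
proof -
  have "continuous_on UNIV (\<lambda>x. - f x)"
    using assms unfolding concave_on_def by (intro convex_on_continuous) auto
  from continuous_on_minus[OF this] show ?thesis by simp
qed

section \<open>Concavity of \<open>khat\<close> and the closed graph of its optimal slopes\<close>

locale dual_objective = bordered_matrix g H + penalty \<rho>
  for g :: "real^'n" and H and \<rho>
begin

definition K :: "real \<Rightarrow> real" where
  "K t = real_of_ereal (khat \<rho> g H t)"

text \<open>The slopes in s of the affine functions
  \<open>\<rho> (\<gamma> - 1) + \<gamma> v^T A(s) v\<close> that are optimal at t, with
  \<open>A(s)\<close> the bordered matrix.\<close>

definition slopes :: "real \<Rightarrow> real set" where
  "slopes t = {\<gamma> * (v $ None)\<^sup>2 | \<gamma> v. \<gamma> \<in> minimizers (lam g H t) \<and> v \<in> min_eigenvectors t}"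

lemma khat_obj_eq: "khat_obj \<rho> g H t \<gamma> = obj (lam g H t) \<gamma>"
  by (simp add: khat_obj_def obj_def)

lemma khat_eq_val: "khat \<rho> g H t = val (lam g H t)"
  by (simp add: khat_def val_def khat_obj_eq)

lemma khat_minimizers_eq: "khat_minimizers \<rho> g H t = minimizers (lam g H t)"
  by (simp add: khat_minimizers_def minimizers_def khat_obj_eq khat_eq_val)

lemma khat_eq: "khat \<rho> g H t = ereal (K t)"
  using val_finite[of "lam g H t"] by (simp add: K_def khat_eq_val ereal_real)

lemma K_nonpos: "K t \<le> 0"
  using val_le[of 0 "lam g H t"] khat_eq[of t] by (simp add: obj_zero khat_eq_val)

lemma slopes_nonempty: "slopes t \<noteq> {}"
  using minimizers_nonempty[of "lam g H t"] min_eigenvectors_nonempty[of t]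
  unfolding slopes_def by blast

text \<open>Keeping the optimal pair at t fixed gives an affine upper bound on \<open>K\<close> that
  is tight at t.\<close>

lemma slopes_supergradient:
  assumes "d \<in> slopes t"
  shows "K s \<le> K t + d * (s - t)"
proof -
  obtain \<gamma> v where d: "d = \<gamma> * (v $ None)\<^sup>2" and \<gamma>: "\<gamma> \<in> minimizers (lam g H t)"
    and v: "v \<in> min_eigenvectors t"
    using assms by (auto simp: slopes_def)
  have "0 \<le> \<gamma>" and obj: "obj (lam g H t) \<gamma> = ereal (K t)"
    using \<gamma> by (simp_all add: minimizers_def khat_eq flip: khat_eq_val)
  have "\<gamma> * lam g H s \<le> \<gamma> * (lam g H t + (v $ None)\<^sup>2 * (s - t))"
    using lam_supergradient[OF v] \<open>0 \<le> \<gamma>\<close> by (intro mult_left_mono)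
  then have "\<gamma> * lam g H s \<le> \<gamma> * lam g H t + d * (s - t)"
    by (simp add: d algebra_simps)
  then have "obj (lam g H s) \<gamma> \<le> ereal (K t + d * (s - t))"
    using obj by (cases "\<rho> (\<gamma> - 1)") (auto simp: obj_def)
  moreover have "ereal (K s) \<le> obj (lam g H s) \<gamma>"
    using val_le[OF \<open>0 \<le> \<gamma>\<close>, of "lam g H s"] khat_eq[of s] by (simp add: khat_eq_val)
  ultimately show ?thesis by (metis ereal_less_eq(3) order.trans)
qed

lemma K_concave: "concave_on UNIV K"
  using slopes_nonempty slopes_supergradient by (intro concave_on_real_supergradient) blast

lemma K_continuous: "continuous_on UNIV K"
  by (rule concave_on_real_continuous[OF K_concave])

lemma lam_continuous: "continuous_on UNIV (lam g H)"
proof (intro concave_on_real_continuous concave_on_real_supergradient)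
  fix t
  obtain v where "v \<in> min_eigenvectors t" using min_eigenvectors_nonempty by blast
  then show "\<exists>d. \<forall>s. lam g H s \<le> lam g H t + d * (s - t)"
    using lam_supergradient by blast
qed

text \<open>Extract twice: first the multipliers converge by coercivity, then the vectors by
  compactness of the sphere. Continuity of \<open>lam\<close> and \<open>K\<close> makes both limits
  optimal at \<open>t0\<close>.\<close>

lemma slopes_closed_graph:
  assumes t: "t \<longlonglongrightarrow> t0" and d: "\<And>n. d n \<in> slopes (t n)"
  obtains r d0 where "strict_mono r" "(d \<circ> r) \<longlonglongrightarrow> d0" "d0 \<in> slopes t0"
proof -
  obtain \<gamma> v where \<gamma>: "\<And>n. \<gamma> n \<in> minimizers (lam g H (t n))"
    and v: "\<And>n. v n \<in> min_eigenvectors (t n)" and d_eq: "\<And>n. d n = \<gamma> n * (v n $ None)\<^sup>2"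
    using d unfolding slopes_def mem_Collect_eq by metis
  have lim_lam: "(\<lambda>n. lam g H (t n)) \<longlonglongrightarrow> lam g H t0" and lim_K: "(\<lambda>n. K (t n)) \<longlonglongrightarrow> K t0"
    using lam_continuous K_continuous t
    by (auto simp: continuous_on_eq_continuous_at intro: isCont_tendsto_compose)
  have "0 \<le> \<gamma> n" "obj (lam g H (t n)) (\<gamma> n) \<le> ereal (K (t n))" for n
    using \<gamma>[of n] by (simp_all add: minimizers_def khat_eq flip: khat_eq_val)
  then obtain r1 \<gamma>0 where r1: "strict_mono r1" "(\<gamma> \<circ> r1) \<longlonglongrightarrow> \<gamma>0" "0 \<le> \<gamma>0"
    "obj (lam g H t0) \<gamma>0 \<le> ereal (K t0)"
    using obj_sublevel_compact[OF _ _ lim_lam lim_K] K_nonpos order.trans[OF _ zero_le_one]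
    by metis
  have \<gamma>0: "\<gamma>0 \<in> minimizers (lam g H t0)"
    using r1 val_le[of \<gamma>0 "lam g H t0"]
    by (auto simp: minimizers_def khat_eq simp flip: khat_eq_val)
  have "(v \<circ> r1) n \<in> sphere 0 1" for n
    using v[of "r1 n"] by (simp add: min_eigenvectors_def)
  then obtain v0 r2 where r2: "v0 \<in> sphere 0 1" "strict_mono r2" "(v \<circ> r1 \<circ> r2) \<longlonglongrightarrow> v0"
    using compact_sphere[of "0 :: real^('n option)" 1] unfolding compact_def by metis
  define r where "r = r1 \<circ> r2"
  have r: "strict_mono r" using r1 r2 by (simp add: r_def strict_mono_o)
  have vr: "(\<lambda>n. v (r n)) \<longlonglongrightarrow> v0" using r2 by (simp add: r_def o_def)
  have tr: "(\<lambda>n. t (r n)) \<longlonglongrightarrow> t0" and lr: "(\<lambda>n. lam g H (t (r n))) \<longlonglongrightarrow> lam g H t0"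
    using LIMSEQ_subseq_LIMSEQ[OF t r] LIMSEQ_subseq_LIMSEQ[OF lim_lam r] by (simp_all add: o_def)
  have \<gamma>r: "(\<lambda>n. \<gamma> (r n)) \<longlonglongrightarrow> \<gamma>0"
    using LIMSEQ_subseq_LIMSEQ[OF r1(2) r2(2)] by (simp add: r_def o_def)
  \<comment> \<open>Isolates the dependence on s in one coordinate, so that the limit involves only
    a fixed matrix.\<close>
  have split: "bordered g H s *v x = bordered g H 0 *v x + (s * x $ None) *\<^sub>R axis None 1" for s x
  proof -
    have "vtail (axis None 1) = (0 :: real^'n)" by (simp add: vtail_def axis_def vec_eq_iff)
    then show ?thesis
      by (subst vec_option_eq_iff) (simp add: bordered_mult axis_def)
  qed
  have "(\<lambda>n. bordered g H 0 *v v (r n) + (t (r n) * v (r n) $ None) *\<^sub>R axis None 1)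
      \<longlonglongrightarrow> bordered g H 0 *v v0 + (t0 * v0 $ None) *\<^sub>R axis None 1"
    by (intro tendsto_intros bounded_linear.tendsto[OF matrix_vector_mul_bounded_linear] vr tr)
  moreover have "bordered g H (t (r n)) *v v (r n) = lam g H (t (r n)) *\<^sub>R v (r n)" for n
    using v[of "r n"] by (simp add: min_eigenvectors_def eigenvector_def)
  ultimately have "(\<lambda>n. lam g H (t (r n)) *\<^sub>R v (r n)) \<longlonglongrightarrow> bordered g H t0 *v v0"
    by (simp flip: split)
  moreover have "(\<lambda>n. lam g H (t (r n)) *\<^sub>R v (r n)) \<longlonglongrightarrow> lam g H t0 *\<^sub>R v0"
    by (intro tendsto_intros lr vr)
  ultimately have "bordered g H t0 *v v0 = lam g H t0 *\<^sub>R v0"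
    using LIMSEQ_unique by blast
  then have "v0 \<in> min_eigenvectors t0"
    using r2(1) by (auto simp: min_eigenvectors_def eigenvector_def)
  then have "\<gamma>0 * (v0 $ None)\<^sup>2 \<in> slopes t0" using \<gamma>0 by (auto simp: slopes_def)
  moreover have "(d \<circ> r) \<longlonglongrightarrow> \<gamma>0 * (v0 $ None)\<^sup>2"
    unfolding o_def d_eq by (intro tendsto_intros \<gamma>r vr)
  ultimately show ?thesis using r that by blast
qed

section \<open>The superdifferential and differentiability of \<open>khat\<close>\<close>

lemma superdifferential_iff:
  "d \<in> superdifferential (khat \<rho> g H) t \<longleftrightarrow> (\<forall>s. K s \<le> K t + d * (s - t))"
proof -
  have "d \<in> superdifferential (khat \<rho> g H) t \<longleftrightarrow> - d \<in> subdifferential (\<lambda>s. - khat \<rho> g H s) t"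
    unfolding superdifferential_def by (metis image_iff minus_minus rev_image_eqI)
  then show ?thesis
    by (simp add: subdifferential_def khat_eq algebra_simps)
qed

text \<open>On the line it suffices to bracket d between two optimal slopes. Conversely, the
  superdifferential is convex and contains all slopes.\<close>

lemma superdifferential_khat: "superdifferential (khat \<rho> g H) t = convex hull slopes t"
proof (intro equalityI subsetI)
  fix d assume "d \<in> superdifferential (khat \<rho> g H) t"
  then have d: "\<And>s. K s \<le> K t + d * (s - t)" by (simp add: superdifferential_iff)
  \<comment> \<open>monotonicity of supergradients\<close>
  have mono: "0 \<le> (d - e) * (s - t)" if "e \<in> slopes s" for e s
    using slopes_supergradient[OF that, of t] d[of s] by (simp add: algebra_simps)
  \<comment> \<open>\<open>c = 1\<close> approaches t from the right and yields a slope at most d;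
    \<open>c = -1\<close> approaches from the left and yields one at least d.\<close>
  have ex: "\<exists>e\<in>slopes t. 0 \<le> (d - e) * c" if c: "c \<noteq> 0" for c :: real
  proof -
    define ts where "ts n = t + c * inverse (Suc n)" for n
    have "\<forall>n. \<exists>e. e \<in> slopes (ts n)" using slopes_nonempty by blast
    then obtain e where e: "\<And>n. e n \<in> slopes (ts n)" by metis
    have "ts \<longlonglongrightarrow> t + c * 0"
      unfolding ts_def by (intro tendsto_intros LIMSEQ_inverse_real_of_nat)
    then obtain r e0 where r: "(e \<circ> r) \<longlonglongrightarrow> e0" "e0 \<in> slopes t"
      using slopes_closed_graph[of ts t e] e by (metis mult_zero_right add_0_right)
    have "0 \<le> (d - e n) * c" for n
    proof -
      have "0 \<le> ((d - e n) * c) * inverse (Suc n)"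
        using mono[OF e, of n] by (simp add: ts_def mult.assoc)
      then show ?thesis by (simp add: zero_le_mult_iff del: of_nat_Suc)
    qed
    moreover have "(\<lambda>n. (d - (e \<circ> r) n) * c) \<longlonglongrightarrow> (d - e0) * c"
      using r by (intro tendsto_intros)
    ultimately have "0 \<le> (d - e0) * c" by (intro LIMSEQ_le_const) auto
    then show ?thesis using r by blast
  qed
  obtain a b where "a \<in> slopes t" "b \<in> slopes t" "a \<le> d" "d \<le> b"
    using ex[of 1] ex[of "-1"] by auto
  then have "d \<in> closed_segment a b" "{a, b} \<subseteq> slopes t"
    by (auto simp: closed_segment_eq_real_ivl)
  then show "d \<in> convex hull slopes t"
    by (metis hull_mono segment_convex_hull subsetD)
next
  have "convex (superdifferential (khat \<rho> g H) t)"
  proof (rule convexI)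
    fix x y u w :: real
    assume x: "x \<in> superdifferential (khat \<rho> g H) t" and y: "y \<in> superdifferential (khat \<rho> g H) t"
      and u: "0 \<le> u" "0 \<le> w" "u + w = 1"
    show "u *\<^sub>R x + w *\<^sub>R y \<in> superdifferential (khat \<rho> g H) t"
      unfolding superdifferential_iff
    proof
      fix s
      have "u * K s + w * K s \<le> u * (K t + x * (s - t)) + w * (K t + y * (s - t))"
        using x y u unfolding superdifferential_iff by (intro add_mono mult_left_mono) auto
      also have "\<dots> = (u + w) * K t + (u *\<^sub>R x + w *\<^sub>R y) * (s - t)"
        by (simp add: algebra_simps)
      finally show "K s \<le> K t + (u *\<^sub>R x + w *\<^sub>R y) * (s - t)"
        using u by (simp flip: distrib_right)
    qed
  qed
  moreover have "slopes t \<subseteq> superdifferential (khat \<rho> g H) t"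
    using slopes_supergradient by (auto simp: superdifferential_iff)
  ultimately show "d \<in> superdifferential (khat \<rho> g H) t" if "d \<in> convex hull slopes t" for d
    using that hull_minimal by blast
qed

text \<open>The supergradients at s and at t trap the difference quotient between d and any slope at
  s, so slopes near t need only be close to d.\<close>

lemma K_differentiable:
  assumes "slopes t = {d}"
  shows "(K has_real_derivative d) (at t)"
  unfolding has_field_derivative_iff LIM_eq
proof (intro allI impI)
  fix \<epsilon> :: real assume "0 < \<epsilon>"
  have "\<exists>\<delta>>0. \<forall>s e. \<bar>s - t\<bar> < \<delta> \<longrightarrow> e \<in> slopes s \<longrightarrow> \<bar>e - d\<bar> < \<epsilon>"
  \<comment> \<open>Otherwise slopes at points tending to t stay \<epsilon> away from d, while the
    closed graph gives a subsequence tending to the only slope d.\<close>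
  proof (rule ccontr)
    assume neg: "\<not> ?thesis"
    have "\<exists>s e. \<bar>s - t\<bar> < inverse (Suc n) \<and> e \<in> slopes s \<and> \<epsilon> \<le> \<bar>e - d\<bar>" for n
    proof -
      have "\<forall>\<delta>>0. \<exists>s e. \<bar>s - t\<bar> < \<delta> \<and> e \<in> slopes s \<and> \<not> \<bar>e - d\<bar> < \<epsilon>"
        using neg by blast
      from this[rule_format, of "inverse (Suc n)"] show ?thesis
        by (simp add: not_less del: of_nat_Suc)
    qed
    then obtain s e where s: "\<And>n. \<bar>s n - t\<bar> < inverse (Suc n)"
      and e: "\<And>n. e n \<in> slopes (s n)" "\<And>n. \<epsilon> \<le> \<bar>e n - d\<bar>" by metis
    have "(\<lambda>n. s n - t) \<longlonglongrightarrow> 0"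
      using s by (intro Lim_null_comparison[OF _ LIMSEQ_inverse_real_of_nat])
        (auto intro!: always_eventually less_imp_le)
    then have "s \<longlonglongrightarrow> t" by (simp add: LIM_zero_iff)
    then obtain r where r: "(e \<circ> r) \<longlonglongrightarrow> d"
      using slopes_closed_graph[of s t e] e(1) assms by (metis singletonD)
    then have "(\<lambda>n. \<bar>(e \<circ> r) n - d\<bar>) \<longlonglongrightarrow> \<bar>d - d\<bar>" by (intro tendsto_intros)
    then have "\<epsilon> \<le> \<bar>d - d\<bar>" using e(2) by (intro LIMSEQ_le_const) auto
    then show False using \<open>0 < \<epsilon>\<close> by simp
  qed
  then obtain \<delta> where \<delta>: "0 < \<delta>" "\<And>s e. \<bar>s - t\<bar> < \<delta> \<Longrightarrow> e \<in> slopes s \<Longrightarrow> \<bar>e - d\<bar> < \<epsilon>"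
    by blast
  have "\<bar>(K s - K t) / (s - t) - d\<bar> < \<epsilon>" if s: "s \<noteq> t" "\<bar>s - t\<bar> < \<delta>" for s
  proof -
    obtain e where e: "e \<in> slopes s" using slopes_nonempty by blast
    have bounds: "K s - K t \<le> d * (s - t)" "e * (s - t) \<le> K s - K t"
      using slopes_supergradient[of d t s] slopes_supergradient[OF e, of t] assms
      by (auto simp: algebra_simps)
    have "\<bar>(K s - K t) / (s - t) - d\<bar> \<le> \<bar>e - d\<bar>"
    proof (cases "s > t")
      case True
      then have "(K s - K t) / (s - t) \<le> d" "e \<le> (K s - K t) / (s - t)"
        using bounds by (simp_all add: pos_divide_le_eq pos_le_divide_eq)
      then show ?thesis by linarith
    next
      case False
      then have "d \<le> (K s - K t) / (s - t)" "(K s - K t) / (s - t) \<le> e"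
        using bounds s by (simp_all add: neg_divide_le_eq neg_le_divide_eq)
      then show ?thesis by linarith
    qed
    then show ?thesis using \<delta>(2)[OF s(2) e] by linarith
  qed
  then show "\<exists>\<delta>>0. \<forall>s. s \<noteq> t \<and> norm (s - t) < \<delta> \<longrightarrow> norm ((K s - K t) / (s - t) - d) < \<epsilon>"
    using \<delta>(1) by auto
qed

lemma khat_differentiable:
  assumes t: "t \<notin> exceptional_points g H"
  shows "ereal_differentiable_at (khat \<rho> g H) t"
proof -
  have "K differentiable at t"
  proof (cases "ereal t < tbar g H")
    case True
    note less = lam_less_lambda_min[OF True]
    \<comment> \<open>Only \<open>lam g H t = 0\<close> could allow several multipliers; as
      \<open>lam g H t < lH\<close>, this would give \<open>lH > 0\<close> and make t the second
      exceptional point.\<close>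
    have "minimizers (lam g H t) = {\<gamma>}" if "\<gamma> \<in> minimizers (lam g H t)" for \<gamma>
    proof (cases "lam g H t = 0")
      case True
      then have "t \<in> exceptional_points g H"
        using less lam_zero_imp by (simp add: exceptional_points_def Lim_lam_tbar)
      then show ?thesis using t by simp
    next
      case False
      then show ?thesis using that minimizers_eq[of "lam g H t"] by (auto split: if_splits)
    qed
    then have "x = y" if "x \<in> slopes t" "y \<in> slopes t" for x y
      using that min_eigenvector_lead_unique[OF less] unfolding slopes_def mem_Collect_eq
      by (metis singletonD)
    then obtain d where "slopes t = {d}" using slopes_nonempty[of t] by blast
    then show ?thesis using K_differentiable real_differentiable_def by blast
  next
    case False
    then have gt: "tbar g H < ereal t" using t by (auto simp: exceptional_points_def)
    \<comment> \<open>On the open half-line above \<open>b\<close> the eigenvalue is constantly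
      \<open>lH\<close>, so \<open>K\<close> is constant near t.\<close>
    obtain b where b: "tbar g H < ereal b" "b < t"
      using ereal_dense2[OF gt] by auto
    have "K t = K s" if "s \<in> {b<..}" for s
    proof -
      have "ereal b < ereal s" using that by simp
      then have "tbar g H \<le> ereal s" using b by order
      then show ?thesis
        using lam_eq_lambda_min gt by (simp add: K_def khat_eq_val)
    qed
    then have "(K has_real_derivative 0) (at t)"
      by (rule has_field_derivative_transform_within_open[of "\<lambda>_. K t" 0 t "{b<..}", rotated 3])
        (simp_all only: DERIV_const open_greaterThan greaterThan_iff b)
    then show ?thesis using real_differentiable_def by blast
  qed
  then show ?thesis
    unfolding ereal_differentiable_at_def by (simp add: khat_eq)
qed

end

theorem theorem3p7:
  fixes g :: "real^'n" and H :: "real^'n^'n" and \<rho> :: "real \<Rightarrow> ereal"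
  assumes "g \<noteq> 0"
    and "transpose H = H"
    and "\<forall>t. 0 \<le> \<rho> t"
    and "proper_closed_convex \<rho>"
    and "\<rho> 0 = 0"
    and "mono \<rho>" and "\<forall>t\<le>0. \<rho> t = 0" and "\<exists>t0>0. \<rho> t0 < \<infinity>"
    and "((\<lambda>t. \<rho> t / ereal t) \<longlongrightarrow> \<infinity>) at_top"
    and "\<forall>u>0. ereal_differentiable_at (monotone_conjugate \<rho>) u"
  shows
    "(\<forall>t. (\<exists>\<gamma>\<ge>0. khat_obj \<rho> g H t \<gamma> = khat \<rho> g H t) \<and>
          khat_minimizers \<rho> g H t =
            (if lam g H t > 0 then {0}
             else if lam g H t = 0 then ((\<lambda>x. x + 1) ` argmin_set \<rho>) \<inter> {0..}
             else {ereal_deriv (monotone_conjugate \<rho>) (- lam g H t) + 1}))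
     \<and>
     ((\<forall>t. \<bar>khat \<rho> g H t\<bar> \<noteq> \<infinity>) \<and>
      continuous_on UNIV (\<lambda>t. real_of_ereal (khat \<rho> g H t)) \<and>
      concave_on UNIV (\<lambda>t. real_of_ereal (khat \<rho> g H t)))
     \<and>
     (\<forall>t. superdifferential (khat \<rho> g H) t =
          convex hull {\<gamma> * (v $ None)\<^sup>2 | \<gamma> v.
            \<gamma> \<in> khat_minimizers \<rho> g H t \<and> norm v = 1 \<and>
            eigenvector (bordered g H t) v (lam g H t)})
     \<and>
     (\<forall>t. t \<notin> exceptional_points g H \<longrightarrow> ereal_differentiable_at (khat \<rho> g H) t)"
proof -
  interpret dual_objective g H \<rho>
    using assms by unfold_locales (auto simp: proper_closed_convex_def)
  have "\<exists>\<gamma>\<ge>0. khat_obj \<rho> g H t \<gamma> = khat \<rho> g H t" for t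
    using minimizers_nonempty[of "lam g H t"]
    by (auto simp: minimizers_def khat_obj_eq khat_eq_val)
  moreover have "\<bar>khat \<rho> g H t\<bar> \<noteq> \<infinity>" for t by (simp add: khat_eq)
  moreover have "superdifferential (khat \<rho> g H) t =
      convex hull {\<gamma> * (v $ None)\<^sup>2 | \<gamma> v. \<gamma> \<in> khat_minimizers \<rho> g H t \<and> norm v = 1 \<and>
        eigenvector (bordered g H t) v (lam g H t)}" for t
    unfolding superdifferential_khat slopes_def khat_minimizers_eq min_eigenvectors_def by simp
  moreover note K_continuous[unfolded K_def] K_concave[unfolded K_def] khat_differentiable
  ultimately show ?thesis
    unfolding khat_minimizers_eq minimizers_eq[symmetric] by blast
qed

end
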